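(* Let $n\geq 2$, let $k$ be an integer with $1\leq k\leq n-1$, and let $J=\{j_1,\dots,j_k\}$ with $2\leq j_1<j_2<\cdots<j_k\leq n$. Then the subgraphs of the augmented cube $AQ_n$ induced by the edge sets $$\bigcup_{i\in\{1,\dots,n\}\setminus J}E_i\ \cup\ \bigcup_{j\in J}E_{\leq j} \qquad\text{and}\qquad E_1\ \cup\ \bigcup_{j\in J}E_j\ \cup\ \bigcup_{i\in\{2,\dots,n\}\setminus J}E_{\leq i}$$ are both isomorphic to the hypercube $Q_n$.
   Context: The hypercube $Q_n$ has vertex set $\{0,1\}^n$, two vertices adjacent iff they differ in exactly one bit. The augmented cube $AQ_n$ has vertex set $\{0,1\}^n$ (strings $x_n\cdots x_1$) and edge set $\left(\bigcup_{i=1}^n E_i\right)\cup\left(\bigcup_{j=2}^n E_{\leq j}\right)$, where $E_i=\{(x_n\cdots x_1,\ x_n\cdots x_{i+1}(x_i+1)x_{i-1}\cdots x_1)\}$ (hypercube edges of dimension $i$: flip bit $i$) and $E_{\leq j}=\{(x_n\cdots x_1,\ x_n\cdots x_{j+1}(x_j+1)\cdots(x_1+1))\}$ (augmented edges of dimension $j$: flip bits $1,\dots,j$), addition mod 2. The subgraph induced by an edge set $E$ has edge set $E$ and vertex set the ends of edges in $E$. *)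

theory Defs
  imports "Graph_Theory.Graph_Theory" "HOL-Library.FuncSet" "HOL-Library.Z2"
begin

text \<open>
  Following \<open>Graph_Theory\<close>, an undirected simple graph is a symmetric digraph without loops and
  parallel arcs (locale \<open>graph\<close>): each edge is represented by its two opposite arcs, and
  \<open>digraph_iso\<close> is then isomorphism of graphs. The lemmas below check that the cubes are such
  graphs.
\<close>

text \<open>
  The string \<open>x\<^sub>n \<dots> x\<^sub>1\<close> is the extensional function \<open>x\<close> on \<open>{1..n}\<close> whose value at \<open>i\<close> is
  the bit \<open>x\<^sub>i\<close>; addition on the type \<open>bit\<close> is addition modulo 2.
\<close>

definition bitstrings :: "nat \<Rightarrow> (nat \<Rightarrow> bit) set" where
  "bitstrings n = {1..n} \<rightarrow>\<^sub>E (UNIV :: bit set)"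

definition graph_of :: "'a set \<Rightarrow> ('a \<times> 'a) set \<Rightarrow> ('a, 'a \<times> 'a) pre_digraph" where
  "graph_of V E = \<lparr>verts = V, arcs = E, tail = fst, head = snd\<rparr>"

definition hypercube :: "nat \<Rightarrow> (nat \<Rightarrow> bit, (nat \<Rightarrow> bit) \<times> (nat \<Rightarrow> bit)) pre_digraph" where
  "hypercube n = graph_of (bitstrings n)
     {(x, y). x \<in> bitstrings n \<and> y \<in> bitstrings n \<and> card {i \<in> {1..n}. x i \<noteq> y i} = 1}"

definition flip_at :: "nat \<Rightarrow> (nat \<Rightarrow> bit) \<Rightarrow> nat \<Rightarrow> bit" where
  "flip_at i x = x(i := x i + 1)"

definition flip_upto :: "nat \<Rightarrow> (nat \<Rightarrow> bit) \<Rightarrow> nat \<Rightarrow> bit" where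
  "flip_upto j x = (\<lambda>l. if l \<in> {1..j} then x l + 1 else x l)"

text \<open>
  The sets \<open>E\<^sub>i\<close> and \<open>E\<^bsub>\<le>j\<^esub>\<close>. They contain both orientations of every edge because flipping is
  an involution.
\<close>

definition hyper_edges :: "nat \<Rightarrow> nat \<Rightarrow> ((nat \<Rightarrow> bit) \<times> (nat \<Rightarrow> bit)) set" where
  "hyper_edges n i = {(x, flip_at i x) | x. x \<in> bitstrings n}"

definition aug_edges :: "nat \<Rightarrow> nat \<Rightarrow> ((nat \<Rightarrow> bit) \<times> (nat \<Rightarrow> bit)) set" where
  "aug_edges n j = {(x, flip_upto j x) | x. x \<in> bitstrings n}"

definition augmented_cube :: "nat \<Rightarrow> (nat \<Rightarrow> bit, (nat \<Rightarrow> bit) \<times> (nat \<Rightarrow> bit)) pre_digraph" where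
  "augmented_cube n = graph_of (bitstrings n)
     ((\<Union>i\<in>{1..n}. hyper_edges n i) \<union> (\<Union>j\<in>{2..n}. aug_edges n j))"

text \<open>Meant for \<open>F \<subseteq> arcs G\<close>; see \<open>subgraph_edge_induced\<close>.\<close>

definition edge_induced_subgraph :: "('a, 'b) pre_digraph \<Rightarrow> 'b set \<Rightarrow> ('a, 'b) pre_digraph" where
  "edge_induced_subgraph G F =
     \<lparr>verts = tail G ` F \<union> head G ` F, arcs = F, tail = tail G, head = head G\<rparr>"

lemma subgraph_edge_induced:
  assumes "wf_digraph G" "F \<subseteq> arcs G"
  shows "subgraph (edge_induced_subgraph G F) G"
  using assms
  by (auto simp: subgraph_def edge_induced_subgraph_def wf_digraph_def compatible_def)

lemma hyper_edges_subset_augmented_cube: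
  "i \<in> {1..n} \<Longrightarrow> hyper_edges n i \<subseteq> arcs (augmented_cube n)"
  by (auto simp: augmented_cube_def graph_of_def)

lemma aug_edges_subset_augmented_cube:
  "j \<in> {2..n} \<Longrightarrow> aug_edges n j \<subseteq> arcs (augmented_cube n)"
  by (auto simp: augmented_cube_def graph_of_def)

lemma finite_bitstrings: "finite (bitstrings n)"
proof -
  have "(UNIV :: bit set) = {0, 1}" by (auto intro: bit.exhaust)
  then have "finite (UNIV :: bit set)" by (metis finite.emptyI finite.insertI)
  then show ?thesis unfolding bitstrings_def by (intro finite_PiE) auto
qed

lemma graph_graph_of:
  assumes "finite V" "E \<subseteq> V \<times> V" "sym E" "irrefl E"
  shows "graph (graph_of V E)"
proof -
  have "finite E" using assms finite_subset by blast
  then show ?thesis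
    using assms
    by unfold_locales
      (auto simp: graph_of_def arc_to_ends_def symmetric_def arcs_ends_def irrefl_def)
qed

lemma flip_at_in: "i \<in> {1..n} \<Longrightarrow> x \<in> bitstrings n \<Longrightarrow> flip_at i x \<in> bitstrings n"
  by (auto simp: bitstrings_def flip_at_def PiE_def extensional_def)

lemma flip_upto_in: "j \<le> n \<Longrightarrow> x \<in> bitstrings n \<Longrightarrow> flip_upto j x \<in> bitstrings n"
  by (auto simp: bitstrings_def flip_upto_def PiE_def extensional_def)

lemma bit_add_self: "(b :: bit) + 1 + 1 = b"
  by (cases b) simp_all

lemma flip_at_flip_at: "flip_at i (flip_at i x) = x"
  by (simp add: fun_eq_iff flip_at_def bit_add_self del: add_bit_eq_xor)

lemma flip_upto_flip_upto: "flip_upto j (flip_upto j x) = x"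
  by (simp add: fun_eq_iff flip_upto_def bit_add_self)

lemma bit_add_1_neq: "(b :: bit) + 1 \<noteq> b"
  by (cases b) simp_all

lemma flip_at_neq: "flip_at i x \<noteq> x"
proof
  assume "flip_at i x = x"
  then have "flip_at i x i = x i" by (rule fun_cong)
  then show False using bit_add_1_neq by (simp only: flip_at_def fun_upd_same)
qed

lemma flip_upto_neq:
  assumes "1 \<le> j" shows "flip_upto j x \<noteq> x"
proof
  assume "flip_upto j x = x"
  then have "flip_upto j x j = x j" by (rule fun_cong)
  moreover have "flip_upto j x j = x j + 1" using assms by (simp add: flip_upto_def)
  ultimately show False using bit_add_1_neq by metis
qed

lemma sym_hyper_edges:
  assumes "i \<in> {1..n}" shows "sym (hyper_edges n i)"
proof (rule symI)
  fix x y assume "(x, y) \<in> hyper_edges n i"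
  then show "(y, x) \<in> hyper_edges n i"
    using flip_at_in[OF assms] unfolding hyper_edges_def by (force simp: flip_at_flip_at)
qed

lemma sym_aug_edges:
  assumes "j \<le> n" shows "sym (aug_edges n j)"
proof (rule symI)
  fix x y assume "(x, y) \<in> aug_edges n j"
  then show "(y, x) \<in> aug_edges n j"
    using flip_upto_in[OF assms] unfolding aug_edges_def by (force simp: flip_upto_flip_upto)
qed

lemma graph_hypercube: "graph (hypercube n)"
proof -
  have "{i \<in> {1..n}. x i \<noteq> y i} = {i \<in> {1..n}. y i \<noteq> x i}" for x y :: "nat \<Rightarrow> bit"
    by metis
  then have "sym {(x, y). x \<in> bitstrings n \<and> y \<in> bitstrings n \<and>
      card {i \<in> {1..n}. x i \<noteq> y i} = 1}"
    unfolding sym_def by (metis (no_types, lifting) case_prodD case_prodI mem_Collect_eq)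
  then show ?thesis
    unfolding hypercube_def
    by (intro graph_graph_of finite_bitstrings) (auto simp: irrefl_def)
qed

lemma graph_augmented_cube: "graph (augmented_cube n)"
  unfolding augmented_cube_def
proof (rule graph_graph_of)
  show "(\<Union>i\<in>{1..n}. hyper_edges n i) \<union> (\<Union>j\<in>{2..n}. aug_edges n j)
    \<subseteq> bitstrings n \<times> bitstrings n"
    by (auto simp: hyper_edges_def aug_edges_def intro: flip_at_in flip_upto_in)
  show "sym ((\<Union>i\<in>{1..n}. hyper_edges n i) \<union> (\<Union>j\<in>{2..n}. aug_edges n j))"
    by (intro sym_Un sym_UNION ballI sym_hyper_edges sym_aug_edges) auto
  show "irrefl ((\<Union>i\<in>{1..n}. hyper_edges n i) \<union> (\<Union>j\<in>{2..n}. aug_edges n j))"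
    by (auto simp: irrefl_def hyper_edges_def aug_edges_def flip_at_neq flip_upto_neq
        flip_at_neq[symmetric] flip_upto_neq[symmetric])
qed (rule finite_bitstrings)

end

theory Submission
  imports Defs
begin

text \<open>
  Flipping \<open>i\<close>, or flipping \<open>1, \<dots>, i\<close>, is translation by a vector of \<open>\<int>\<^sub>2\<^sup>n\<close> whose last nonzero
  coordinate is the \<open>i\<close>-th. One such vector for each \<open>i\<close> gives a triangular basis, and the linear
  map carrying the standard basis to it is an isomorphism from the hypercube onto the graph whose
  edges are the chosen flips.
\<close>

text \<open>\<open>K\<close> records the dimensions whose augmented flip is chosen, so that both
  edge sets of the theorem become instances of one family.\<close>

definition mixed_flip :: "nat set \<Rightarrow> nat \<Rightarrow> (nat \<Rightarrow> bit) \<Rightarrow> nat \<Rightarrow> bit" where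
  "mixed_flip K i = (if i \<in> K then flip_upto i else flip_at i)"

definition mixed_edges :: "nat \<Rightarrow> nat set \<Rightarrow> ((nat \<Rightarrow> bit) \<times> (nat \<Rightarrow> bit)) set" where
  "mixed_edges n K = {(x, mixed_flip K i x) | x i. x \<in> bitstrings n \<and> i \<in> {1..n}}"

text \<open>This is the coordinate form of the sum of \<open>x i\<close> times \<open>v i\<close>,
  where \<open>v i\<close> is the translation vector of \<open>mixed_flip K i\<close>: its
  \<open>l\<close>-th entry is 1 iff \<open>l = i\<close>, or \<open>i \<in> K\<close> and
  \<open>l < i\<close>. The value \<open>undefined\<close> keeps the result extensional.\<close>

definition mixed_map :: "nat \<Rightarrow> nat set \<Rightarrow> (nat \<Rightarrow> bit) \<Rightarrow> nat \<Rightarrow> bit" where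
  "mixed_map n K x =
     (\<lambda>l. if l \<in> {1..n} then x l + (\<Sum>i\<in>K \<inter> {l<..n}. x i) else undefined)"

text \<open>Passes to the shape of the theorem. The bound on \<open>K\<close> matters because the
  right-hand union runs over all of \<open>K\<close>, whereas \<open>mixed_edges\<close> only uses
  dimensions in \<open>{1..n}\<close>.\<close>

lemma mixed_edges_eq:
  assumes "K \<subseteq> {1..n}"
  shows "mixed_edges n K = (\<Union>i\<in>{1..n} - K. hyper_edges n i) \<union> (\<Union>i\<in>K. aug_edges n i)"
    (is "_ = ?R")
proof
  show "mixed_edges n K \<subseteq> ?R"
  proof
    fix e assume "e \<in> mixed_edges n K"
    then obtain x i where "e = (x, mixed_flip K i x)" "x \<in> bitstrings n" "i \<in> {1..n}"
      unfolding mixed_edges_def by blast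
    then show "e \<in> ?R"
      by (cases "i \<in> K") (auto simp: mixed_flip_def hyper_edges_def aug_edges_def)
  qed
  show "?R \<subseteq> mixed_edges n K"
  proof
    fix e assume "e \<in> ?R"
    then obtain i x where "i \<in> {1..n}" "x \<in> bitstrings n" "e = (x, mixed_flip K i x)"
      using assms by (auto simp: mixed_flip_def hyper_edges_def aug_edges_def)
    then show "e \<in> mixed_edges n K"
      unfolding mixed_edges_def by blast
  qed
qed

lemma mixed_flip_in:
  "i \<in> {1..n} \<Longrightarrow> x \<in> bitstrings n \<Longrightarrow> mixed_flip K i x \<in> bitstrings n"
  by (simp add: mixed_flip_def flip_at_in flip_upto_in)

lemma mixed_map_in: "mixed_map n K x \<in> bitstrings n"
  by (auto simp: mixed_map_def bitstrings_def)

text \<open>By linearity, adding the \<open>i\<close>-th standard basis vector to \<open>x\<close>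
  adds \<open>v i\<close> to the image.\<close>

lemma mixed_map_flip_at:
  assumes "i \<in> {1..n}"
  shows "mixed_map n K (flip_at i x) = mixed_flip K i (mixed_map n K x)"
proof
  fix l
  \<comment> \<open>Written as an added indicator, the flip can be split off the sum by
    \<open>sum.distrib\<close> and evaluated by \<open>sum.delta\<close>.\<close>
  have flip: "flip_at i x m = x m + (if i = m then 1 else 0)" for m
    by (simp add: flip_at_def del: add_bit_eq_xor)
  have "(\<Sum>m\<in>K \<inter> {l<..n}. flip_at i x m) =
      (\<Sum>m\<in>K \<inter> {l<..n}. x m) + (if i \<in> K \<and> l < i then 1 else 0)"
    using assms by (simp add: flip sum.distrib sum.delta del: add_bit_eq_xor)
  then show "mixed_map n K (flip_at i x) l = mixed_flip K i (mixed_map n K x) l"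
    using assms
    by (auto simp: mixed_map_def mixed_flip_def flip_upto_def flip_at_def ac_simps
        simp del: add_bit_eq_xor)
qed

text \<open>Triangularity: at the largest position where \<open>x\<close> and \<open>y\<close>
  differ, the correction sums involve only larger indices, hence agree, so the images differ
  there.\<close>

lemma inj_on_mixed_map: "inj_on (mixed_map n K) (bitstrings n)"
proof (rule inj_onI, rule ccontr)
  fix x y
  assume x: "x \<in> bitstrings n" and y: "y \<in> bitstrings n"
    and eq: "mixed_map n K x = mixed_map n K y" and "x \<noteq> y"
  define D where "D = {i \<in> {1..n}. x i \<noteq> y i}"
  have "D \<noteq> {}"
    using PiE_ext[OF x[unfolded bitstrings_def] y[unfolded bitstrings_def]] \<open>x \<noteq> y\<close>
    unfolding D_def by blast
  moreover have "finite D" by (simp add: D_def)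
  ultimately have D: "Max D \<in> D" "\<And>i. i \<in> D \<Longrightarrow> i \<le> Max D" by auto
  have "x i = y i" if "i \<in> K \<inter> {Max D<..n}" for i
  proof (rule ccontr)
    assume "x i \<noteq> y i"
    then have "i \<in> D" using that by (simp add: D_def)
    then show False using that D(2)[of i] by simp
  qed
  then have "(\<Sum>i\<in>K \<inter> {Max D<..n}. x i) = (\<Sum>i\<in>K \<inter> {Max D<..n}. y i)"
    by (rule sum.cong[OF refl])
  moreover have "mixed_map n K x (Max D) = mixed_map n K y (Max D)" by (simp only: eq)
  ultimately have "x (Max D) = y (Max D)"
    using D(1) by (simp add: mixed_map_def D_def del: add_bit_eq_xor)
  then show False using D(1) by (simp add: D_def)
qed

text \<open>Surjectivity comes from finiteness, without an explicit inverse.\<close>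

lemma bij_betw_mixed_map: "bij_betw (mixed_map n K) (bitstrings n) (bitstrings n)"
  unfolding bij_betw_def
  using endo_inj_surj[OF finite_bitstrings _ inj_on_mixed_map] inj_on_mixed_map mixed_map_in
  by blast

lemma bit_neq_iff: "(a :: bit) \<noteq> b \<longleftrightarrow> b = a + 1"
  by (cases a; cases b) simp_all

text \<open>Puts the hypercube into the same family, at \<open>K = {}\<close>. Bits take two values,
  so differing exactly at \<open>i\<close> determines \<open>y\<close> from
  \<open>x\<close>.\<close>

lemma arcs_hypercube: "arcs (hypercube n) = mixed_edges n {}"
proof -
  have "card {i \<in> {1..n}. x i \<noteq> y i} = 1 \<longleftrightarrow> (\<exists>i\<in>{1..n}. y = flip_at i x)"
    if x: "x \<in> bitstrings n" and y: "y \<in> bitstrings n" for x y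
  proof
    assume "card {i \<in> {1..n}. x i \<noteq> y i} = 1"
    then obtain i where i: "{i \<in> {1..n}. x i \<noteq> y i} = {i}"
      by (auto simp: card_1_singleton_iff)
    then have "i \<in> {1..n}" by blast
    moreover have "y = flip_at i x"
    proof (rule PiE_ext)
      show "y \<in> {1..n} \<rightarrow>\<^sub>E UNIV" "flip_at i x \<in> {1..n} \<rightarrow>\<^sub>E UNIV"
        using y flip_at_in[OF \<open>i \<in> {1..n}\<close> x] by (simp_all add: bitstrings_def)
      fix l assume "l \<in> {1..n}"
      then have "x l \<noteq> y l \<longleftrightarrow> l = i" using i by blast
      then show "y l = flip_at i x l"
        using bit_neq_iff[of "x l" "y l"] by (cases "l = i") (simp_all add: flip_at_def)
    qed
    ultimately show "\<exists>i\<in>{1..n}. y = flip_at i x" by blast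
  next
    assume "\<exists>i\<in>{1..n}. y = flip_at i x"
    then obtain i where "i \<in> {1..n}" "y = flip_at i x" by blast
    moreover have "x l \<noteq> flip_at i x l \<longleftrightarrow> l = i" for l
      using bit_add_1_neq[of "x l"] unfolding flip_at_def fun_upd_apply by metis
    ultimately have "{i \<in> {1..n}. x i \<noteq> y i} = {i}" by blast
    then show "card {i \<in> {1..n}. x i \<noteq> y i} = 1" by simp
  qed
  then have "(x, y) \<in> arcs (hypercube n) \<longleftrightarrow>
      x \<in> bitstrings n \<and> y \<in> bitstrings n \<and> (\<exists>i\<in>{1..n}. y = flip_at i x)" for x y
    unfolding hypercube_def graph_of_def by fastforce
  moreover have "(x, y) \<in> mixed_edges n {} \<longleftrightarrow>
      x \<in> bitstrings n \<and> y \<in> bitstrings n \<and> (\<exists>i\<in>{1..n}. y = flip_at i x)" for x y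
    using flip_at_in unfolding mixed_edges_def mixed_flip_def by fastforce
  ultimately show ?thesis
    by (simp add: set_eq_iff split_paired_all)
qed

text \<open>One inclusion is \<open>mixed_map_flip_at\<close>; the other also lifts the tail of an
  arc through the surjectivity of \<open>mixed_map\<close>.\<close>

lemma image_mixed_edges:
  "map_prod (mixed_map n K) (mixed_map n K) ` mixed_edges n {} = mixed_edges n K"
proof
  show "map_prod (mixed_map n K) (mixed_map n K) ` mixed_edges n {} \<subseteq> mixed_edges n K"
    using mixed_map_in by (auto simp: mixed_edges_def mixed_flip_def[of "{}"] mixed_map_flip_at)
  show "mixed_edges n K \<subseteq> map_prod (mixed_map n K) (mixed_map n K) ` mixed_edges n {}"
  proof
    fix e assume "e \<in> mixed_edges n K"
    then obtain y i where e: "e = (y, mixed_flip K i y)" "y \<in> bitstrings n" "i \<in> {1..n}"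
      unfolding mixed_edges_def by blast
    then obtain x where x: "x \<in> bitstrings n" "y = mixed_map n K x"
      using bij_betw_mixed_map[of n K] unfolding bij_betw_def by blast
    then have "e = map_prod (mixed_map n K) (mixed_map n K) (x, mixed_flip {} i x)"
      using e by (simp add: mixed_map_flip_at mixed_flip_def[of "{}"])
    moreover have "(x, mixed_flip {} i x) \<in> mixed_edges n {}"
      using x e unfolding mixed_edges_def by blast
    ultimately show "e \<in> map_prod (mixed_map n K) (mixed_map n K) ` mixed_edges n {}"
      by (rule image_eqI)
  qed
qed

text \<open>For \<open>n = 0\<close> there are no edges, so the induced subgraph would be empty
  while the hypercube has one vertex.\<close>

lemma digraph_iso_hypercube:
  assumes "1 \<le> n"
  shows "digraph_iso (edge_induced_subgraph (augmented_cube n) (mixed_edges n K)) (hypercube n)"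
\<comment> \<open>\<open>mixed_map\<close> leads from the hypercube to the subgraph, so the
  isomorphism is built in that direction.\<close>
proof (rule digraph_iso_swap)
  let ?f = "mixed_map n K"
  let ?h = "\<lparr>iso_verts = ?f, iso_arcs = map_prod ?f ?f, iso_head = snd, iso_tail = fst\<rparr>"
  show wf: "wf_digraph (hypercube n)"
    using graph_hypercube[of n] unfolding graph_def digraph_def fin_digraph_def by blast
  have cube: "verts (hypercube n) = bitstrings n" "tail (hypercube n) = fst"
      "head (hypercube n) = snd"
    by (simp_all add: hypercube_def graph_of_def)
  have "arcs (hypercube n) \<subseteq> bitstrings n \<times> bitstrings n"
    by (auto simp: hypercube_def graph_of_def)
  then have "inj_on (map_prod ?f ?f) (arcs (hypercube n))"
    using map_prod_inj_on[OF inj_on_mixed_map inj_on_mixed_map] inj_on_subset by blast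
  then have "pre_digraph.digraph_isomorphism (hypercube n) ?h"
    using wf by (simp add: pre_digraph.digraph_isomorphism_def cube inj_on_mixed_map)
  moreover have "fst ` mixed_edges n K \<union> snd ` mixed_edges n K = bitstrings n"
  proof
    show "fst ` mixed_edges n K \<union> snd ` mixed_edges n K \<subseteq> bitstrings n"
      by (auto simp: mixed_edges_def mixed_flip_in)
    show "bitstrings n \<subseteq> fst ` mixed_edges n K \<union> snd ` mixed_edges n K"
    proof
      fix x assume "x \<in> bitstrings n"
      \<comment> \<open>Dimension 1 is available since \<open>1 \<le> n\<close>, so every vertex is
        an end of some chosen edge.\<close>
      then have "(x, mixed_flip K 1 x) \<in> mixed_edges n K"
        using assms unfolding mixed_edges_def by fastforce
      then show "x \<in> fst ` mixed_edges n K \<union> snd ` mixed_edges n K" by force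
    qed
  qed
  \<comment> \<open>The subgraph is literally the image of the hypercube under
    \<open>?h\<close>.\<close>
  then have "edge_induced_subgraph (augmented_cube n) (mixed_edges n K) = app_iso ?h (hypercube n)"
    using bij_betw_mixed_map[of n K]
    by (simp add: edge_induced_subgraph_def augmented_cube_def graph_of_def[of "bitstrings n"]
        app_iso_def cube arcs_hypercube image_mixed_edges bij_betw_def)
  ultimately show "digraph_iso (hypercube n)
      (edge_induced_subgraph (augmented_cube n) (mixed_edges n K))"
    unfolding digraph_iso_def by blast
qed

text \<open>The two claims are the cases \<open>K = J\<close> and \<open>K = {2..n} - J\<close> of
  \<open>digraph_iso_hypercube\<close>.\<close>

theorem theorem3p3:
  fixes n k :: nat and j :: "nat \<Rightarrow> nat" and J :: "nat set"
  assumes "n \<ge> 2"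
    and "1 \<le> k" and "k \<le> n - 1"
    and "J = j ` {1..k}"
    and "2 \<le> j 1" and "strict_mono_on {1..k} j" and "j k \<le> n"
  shows "digraph_iso
           (edge_induced_subgraph (augmented_cube n)
              ((\<Union>i\<in>{1..n} - J. hyper_edges n i) \<union> (\<Union>i\<in>J. aug_edges n i)))
           (hypercube n)
       \<and> digraph_iso
           (edge_induced_subgraph (augmented_cube n)
              (hyper_edges n 1 \<union> (\<Union>i\<in>J. hyper_edges n i) \<union> (\<Union>i\<in>{2..n} - J. aug_edges n i)))
           (hypercube n)"
proof
  have mono: "j a \<le> j b" if "a \<in> {1..k}" "b \<in> {1..k}" "a \<le> b" for a b
    using strict_mono_on_leD[OF assms(6)] that by blast
  have J: "J \<subseteq> {2..n}"
  proof
    fix i assume "i \<in> J"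
    then obtain a where a: "a \<in> {1..k}" "i = j a" using assms(4) by blast
    then have "j 1 \<le> i" "i \<le> j k" using mono[of 1 a] mono[of a k] by auto
    then show "i \<in> {2..n}" using assms(5,7) by simp
  qed
  have n: "1 \<le> n" using assms(1) by simp
  have "J \<subseteq> {1..n}" using J by auto
  then show "digraph_iso
      (edge_induced_subgraph (augmented_cube n)
        ((\<Union>i\<in>{1..n} - J. hyper_edges n i) \<union> (\<Union>i\<in>J. aug_edges n i)))
      (hypercube n)"
    using digraph_iso_hypercube[OF n, of J] by (simp add: mixed_edges_eq)
  \<comment> \<open>Dimension 1 lies outside \<open>K = {2..n} - J\<close>, which accounts for the
    separate term \<open>hyper_edges n 1\<close>.\<close>
  have "{1..n} - ({2..n} - J) = insert 1 J"
    using J n by force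
  moreover have "{2..n} - J \<subseteq> {1..n}" by auto
  ultimately have "mixed_edges n ({2..n} - J) =
      hyper_edges n 1 \<union> (\<Union>i\<in>J. hyper_edges n i) \<union> (\<Union>i\<in>{2..n} - J. aug_edges n i)"
    by (simp add: mixed_edges_eq)
  then show "digraph_iso
      (edge_induced_subgraph (augmented_cube n)
        (hyper_edges n 1 \<union> (\<Union>i\<in>J. hyper_edges n i) \<union> (\<Union>i\<in>{2..n} - J. aug_edges n i)))
      (hypercube n)"
    using digraph_iso_hypercube[OF n, of "{2..n} - J"] by simp
qed

end
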